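(* Let $d\ge 3$, let $X=\{x_1,\dots,x_d\}$ and let $T$ be the $d$-adic tree with vertex set $X^*$. For $i=1,\dots,d-1$ let $b_i\in\operatorname{Aut}T$ be the automorphism defined recursively by: the label of $b_i$ at the root is the transposition $(x_i\; x_{i+1})$, and its sections at the first level are $(b_i)_{x_k}=1$ if $k\in\{i,i+1\}$ and $(b_i)_{x_k}=b_i$ otherwise. Let $G=\langle b_1,\dots,b_{d-1}\rangle\le\operatorname{Aut}T$. Then $G$ acts transitively on each level of $T$, and $G$ is fractal but not strongly fractal.
   Context: The vertices of the $d$-adic tree $T$ are the words in the free monoid $X^*$, $|X|=d$; the root is the empty word $\emptyset$, and $u$ is joined to $ux$ for $x\in X$. $L_n$ is the set of words of length $n$ (the $n$-th level). $\operatorname{Aut}T$ is the group of automorphisms of the rooted tree $T$, with product $fg$ meaning first $f$, then $g$: $(fg)(u)=g(f(u))$. For $g\in\operatorname{Aut}T$ and a vertex $u$, the label $g_{(u)}$ is the permutation $\alpha$ of $X$ with $g(ux)=g(u)\alpha(x)$ for all $x\in X$; the section $g_u\in\operatorname{Aut}T$ is defined by $g(uv)=g(u)g_u(v)$ for all $v\in X^*$. For $G\le\operatorname{Aut}T$, $\operatorname{st}_G(u)$ is the stabilizer of the vertex $u$ in $G$, $\operatorname{st}_G(L_n)=\bigcap_{u\in L_n}\operatorname{st}_G(u)$, and $\psi_u$ is the homomorphism $g\mapsto g_u$ defined on the stabilizer of $u$. $G$ is self-similar if $g_u\in G$ for all $g\in G$ and all vertices $u$. A self-similar group $G$ is fractal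 if $\psi_u(\operatorname{st}_G(u))=G$ for every vertex $u$ of $T$, and strongly fractal if $\psi_x(\operatorname{st}_G(L_1))=G$ for every $x\in X$. *)

theory Defs
  imports "HOL-Algebra.Bij" "HOL-Algebra.Generated_Groups" "HOL-Combinatorics.Transposition"
begin

section \<open>The rooted tree of words over an alphabet\<close>

text \<open>
  Words over \<open>X\<close> are elements of \<^term>\<open>lists X\<close>; the root is the empty list.
\<close>

definition tree_adj :: "'a set \<Rightarrow> 'a list \<Rightarrow> 'a list \<Rightarrow> bool" where
  "tree_adj X u v \<longleftrightarrow> u \<in> lists X \<and> v \<in> lists X \<and> (\<exists>x\<in>X. v = u @ [x] \<or> u = v @ [x])"

definition level :: "'a set \<Rightarrow> nat \<Rightarrow> 'a list set" where
  "level X n = {u \<in> lists X. length u = n}"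

definition tree_auts :: "'a set \<Rightarrow> ('a list \<Rightarrow> 'a list) set" where
  "tree_auts X = {g \<in> Bij (lists X). g [] = [] \<and>
     (\<forall>u\<in>lists X. \<forall>v\<in>lists X. tree_adj X (g u) (g v) \<longleftrightarrow> tree_adj X u v)}"

text \<open>The product is written left to right, so it is not that of \<^const>\<open>BijGroup\<close>.\<close>

definition AutT :: "'a set \<Rightarrow> ('a list \<Rightarrow> 'a list) monoid" where
  "AutT X = \<lparr>carrier = tree_auts X,
     mult = (\<lambda>f g. compose (lists X) g f),
     one = (\<lambda>u\<in>lists X. u)\<rparr>"

text \<open>
  For a tree automorphism \<open>g\<close>, the word \<open>g u\<close> is a prefix of \<open>g (u @ v)\<close>, so that
  \<open>g (u @ [x]) = g u @ [label X g u x]\<close> and \<open>g (u @ v) = g u @ vertex_section X g u v\<close>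
  (lemmas \<open>label_eq\<close>, \<open>vertex_section_eq\<close>). Labels are extended by the identity outside
  \<open>X\<close>, as is usual for permutations of a set.
\<close>

definition label :: "'a set \<Rightarrow> ('a list \<Rightarrow> 'a list) \<Rightarrow> 'a list \<Rightarrow> 'a \<Rightarrow> 'a" where
  "label X g u x = (if x \<in> X then last (g (u @ [x])) else x)"

definition vertex_section ::
    "'a set \<Rightarrow> ('a list \<Rightarrow> 'a list) \<Rightarrow> 'a list \<Rightarrow> 'a list \<Rightarrow> 'a list" where
  "vertex_section X g u = (\<lambda>v\<in>lists X. drop (length (g u)) (g (u @ v)))"


section \<open>Self-similar, fractal and strongly fractal groups\<close>

definition vertex_stab :: "('a list \<Rightarrow> 'a list) set \<Rightarrow> 'a list \<Rightarrow> ('a list \<Rightarrow> 'a list) set" where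
  "vertex_stab G u = {g \<in> G. g u = u}"

definition level_stab ::
    "'a set \<Rightarrow> ('a list \<Rightarrow> 'a list) set \<Rightarrow> nat \<Rightarrow> ('a list \<Rightarrow> 'a list) set" where
  "level_stab X G n = {g \<in> G. \<forall>u\<in>level X n. g \<in> vertex_stab G u}"

definition level_transitive :: "'a set \<Rightarrow> ('a list \<Rightarrow> 'a list) set \<Rightarrow> bool" where
  "level_transitive X G \<longleftrightarrow> (\<forall>n. \<forall>u\<in>level X n. \<forall>v\<in>level X n. \<exists>g\<in>G. g u = v)"

definition self_similar :: "'a set \<Rightarrow> ('a list \<Rightarrow> 'a list) set \<Rightarrow> bool" where
  "self_similar X G \<longleftrightarrow> subgroup G (AutT X) \<and>
     (\<forall>g\<in>G. \<forall>u\<in>lists X. vertex_section X g u \<in> G)"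

definition fractal :: "'a set \<Rightarrow> ('a list \<Rightarrow> 'a list) set \<Rightarrow> bool" where
  "fractal X G \<longleftrightarrow> self_similar X G \<and>
     (\<forall>u\<in>lists X. (\<lambda>g. vertex_section X g u) ` vertex_stab G u = G)"

definition strongly_fractal :: "'a set \<Rightarrow> ('a list \<Rightarrow> 'a list) set \<Rightarrow> bool" where
  "strongly_fractal X G \<longleftrightarrow> self_similar X G \<and>
     (\<forall>x\<in>X. (\<lambda>g. vertex_section X g [x]) ` level_stab X G 1 = G)"


section \<open>The generators\<close>

text \<open>
  The recursion \<open>g (y # v) = label y # section v\<close> for the root label \<open>(x i  x (i+1))\<close>
  and the prescribed first-level sections. That it yields the unique tree automorphism with
  this label and these sections is shown in lemmas \<open>gen_b_characterization\<close> and
  \<open>gen_b_unique\<close> below.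
\<close>

primrec b_word :: "(nat \<Rightarrow> 'a) \<Rightarrow> nat \<Rightarrow> 'a list \<Rightarrow> 'a list" where
  "b_word x i [] = []"
| "b_word x i (y # v) = Transposition.transpose (x i) (x (i + 1)) y #
     (if y \<in> {x i, x (i + 1)} then v else b_word x i v)"

definition gen_b :: "'a set \<Rightarrow> (nat \<Rightarrow> 'a) \<Rightarrow> nat \<Rightarrow> 'a list \<Rightarrow> 'a list" where
  "gen_b X x i = restrict (b_word x i) (lists X)"


section \<open>The definitions are as intended\<close>

lemma tree_auts_bij: "g \<in> tree_auts X \<Longrightarrow> bij_betw g (lists X) (lists X)"
  by (simp add: tree_auts_def Bij_def)

lemma tree_auts_lists: "g \<in> tree_auts X \<Longrightarrow> u \<in> lists X \<Longrightarrow> g u \<in> lists X"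
  using bij_betwE[OF tree_auts_bij] by blast

lemma tree_auts_inj:
  "g \<in> tree_auts X \<Longrightarrow> u \<in> lists X \<Longrightarrow> v \<in> lists X \<Longrightarrow> g u = g v \<Longrightarrow> u = v"
  using tree_auts_bij[of g X] by (auto simp: bij_betw_def inj_on_def)

lemma tree_auts_snoc:
  assumes g: "g \<in> tree_auts X" and u: "u \<in> lists X" and x: "x \<in> X"
  shows "\<exists>y\<in>X. g (u @ [x]) = g u @ [y]"
  using u x
proof (induction u arbitrary: x rule: rev_induct)
  case Nil
  have "[] \<in> lists X" "[x] \<in> lists X" "tree_adj X [] [x]"
    using Nil by (auto simp: tree_adj_def)
  then have "tree_adj X (g []) (g [x])"
    using g unfolding tree_auts_def by blast
  moreover have "g [] = []" using g by (simp add: tree_auts_def)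
  ultimately show ?case by (auto simp: tree_adj_def)
next
  case (snoc z u)
  let ?u = "u @ [z]"
  have mem: "u \<in> lists X" "z \<in> X" "?u \<in> lists X" "?u @ [x] \<in> lists X"
    using snoc.prems by auto
  have "tree_adj X (g ?u) (g (?u @ [x]))"
    using g mem snoc.prems unfolding tree_auts_def tree_adj_def by blast
  then consider y where "y \<in> X" "g (?u @ [x]) = g ?u @ [y]"
    | y where "y \<in> X" "g ?u = g (?u @ [x]) @ [y]"
    unfolding tree_adj_def by blast
  then show ?case
  proof cases
    case 1
    then show ?thesis by blast
  next
    case 2
    obtain y' where "g ?u = g u @ [y']" using snoc.IH mem by blast
    with 2 have "g (?u @ [x]) = g u" by simp
    with tree_auts_inj[OF g mem(4) mem(1)] show ?thesis by simp
  qed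
qed

lemma label_eq:
  assumes "g \<in> tree_auts X" "u \<in> lists X" "x \<in> X"
  shows "label X g u x \<in> X" "g (u @ [x]) = g u @ [label X g u x]"
  using tree_auts_snoc[OF assms] assms(3) by (auto simp: label_def)

lemma vertex_section_eq:
  assumes g: "g \<in> tree_auts X" and u: "u \<in> lists X" and v: "v \<in> lists X"
  shows "g (u @ v) = g u @ vertex_section X g u v"
proof -
  have "\<exists>w. g (u @ v) = g u @ w"
    using v
  proof (induction v rule: rev_induct)
    case (snoc x v)
    then obtain w where "g (u @ v) = g u @ w" by auto
    moreover obtain y where "g ((u @ v) @ [x]) = g (u @ v) @ [y]"
      using tree_auts_snoc[OF g, of "u @ v" x] u snoc.prems by auto
    ultimately show ?case by simp
  qed simp
  then show ?thesis using v by (auto simp: vertex_section_def)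
qed

lemma tree_auts_length:
  assumes g: "g \<in> tree_auts X" and u: "u \<in> lists X"
  shows "length (g u) = length u"
  using u
proof (induction u rule: rev_induct)
  case Nil
  show ?case using g by (simp add: tree_auts_def)
next
  case (snoc x u)
  then show ?case using tree_auts_snoc[OF g, of u x] by auto
qed

lemma tree_autsI:
  assumes ext: "g \<in> extensional (lists X)"
    and bij: "bij_betw g (lists X) (lists X)"
    and Nil: "g [] = []"
    and snoc: "\<And>u x. u \<in> lists X \<Longrightarrow> x \<in> X \<Longrightarrow> \<exists>y\<in>X. g (u @ [x]) = g u @ [y]"
  shows "g \<in> tree_auts X"
proof -
  have mem: "g u \<in> lists X" if "u \<in> lists X" for u using bij that bij_betwE by blast
  have inj: "u = v" if "u \<in> lists X" "v \<in> lists X" "g u = g v" for u v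
    using bij that by (auto simp: bij_betw_def inj_on_def)
  have len: "length (g u) = length u" if "u \<in> lists X" for u
    using that
  proof (induction u rule: rev_induct)
    case (snoc x u)
    then show ?case using assms(4)[of u x] by auto
  qed (simp add: Nil)
  have reflect: "\<exists>x\<in>X. v = u @ [x]"
    if u: "u \<in> lists X" and v: "v \<in> lists X" and y: "g v = g u @ [y]" for u v y
  proof -
    have "length v = Suc (length u)" using len[OF u] len[OF v] y by simp
    then obtain w z where w: "v = w @ [z]" by (metis length_Suc_conv_rev)
    with v have wz: "w \<in> lists X" "z \<in> X" by auto
    then obtain y' where "g v = g w @ [y']" using snoc w by blast
    with y have "g w = g u" by simp
    with inj[OF wz(1) u] w wz show ?thesis by blast
  qed
  have "tree_adj X (g u) (g v) \<longleftrightarrow> tree_adj X u v"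
    if u: "u \<in> lists X" and v: "v \<in> lists X" for u v
  proof
    assume "tree_adj X (g u) (g v)"
    then show "tree_adj X u v"
      unfolding tree_adj_def using reflect[OF u v] reflect[OF v u] u v by blast
  next
    assume "tree_adj X u v"
    then show "tree_adj X (g u) (g v)"
      unfolding tree_adj_def using snoc[OF u] snoc[OF v] mem[OF u] mem[OF v] by blast
  qed
  with ext bij Nil show ?thesis by (simp add: tree_auts_def Bij_def)
qed

lemma vertex_section_in_tree_auts:
  assumes g: "g \<in> tree_auts X" and u: "u \<in> lists X"
  shows "vertex_section X g u \<in> tree_auts X"
proof (rule tree_autsI)
  let ?s = "vertex_section X g u"
  note eq = vertex_section_eq[OF g u]
  have inX: "?s v \<in> lists X" if "v \<in> lists X" for v
    using tree_auts_lists[OF g, of "u @ v"] eq[OF that] u that by auto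
  show "?s \<in> extensional (lists X)" by (simp add: vertex_section_def)
  show "?s [] = []" by (simp add: vertex_section_def)
  show "\<exists>y\<in>X. ?s (v @ [x]) = ?s v @ [y]" if v: "v \<in> lists X" "x \<in> X" for v x
    using tree_auts_snoc[OF g, of "u @ v" x] eq[of v] eq[of "v @ [x]"] u v by auto
  show "bij_betw ?s (lists X) (lists X)"
  proof (rule bij_betwI')
    fix v w assume vw: "v \<in> lists X" "w \<in> lists X"
    show "(?s v = ?s w) = (v = w)"
      using tree_auts_inj[OF g, of "u @ v" "u @ w"] eq[OF vw(1)] eq[OF vw(2)] u vw by auto
  next
    fix v assume "v \<in> lists X" then show "?s v \<in> lists X" by (rule inX)
  next
    fix w assume w: "w \<in> lists X"
    have "g u @ w \<in> lists X" using tree_auts_lists[OF g u] w by simp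
    then obtain t where t: "t \<in> lists X" "g t = g u @ w"
      using tree_auts_bij[OF g] by (metis bij_betw_def imageE)
    define a b where "a = take (length u) t" and "b = drop (length u) t"
    have ab: "t = a @ b" by (simp add: a_def b_def)
    have la: "length a = length u"
      using tree_auts_length[OF g u] tree_auts_length[OF g t(1)] t(2) by (simp add: a_def)
    have mem: "a \<in> lists X" "b \<in> lists X" using t(1) ab by auto
    have "g a @ vertex_section X g a b = g u @ w"
      using vertex_section_eq[OF g mem] ab t(2) by simp
    then have "g a = g u"
      using tree_auts_length[OF g u] tree_auts_length[OF g mem(1)] la by simp
    then have "a = u" using tree_auts_inj[OF g mem(1) u] by simp
    with eq[OF mem(2)] ab t(2) have "w = ?s b" by simp
    with mem show "\<exists>v\<in>lists X. w = ?s v" by blast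
  qed
qed

lemma group_AutT: "group (AutT X)"
proof (rule groupI)
  fix f g assume f: "f \<in> carrier (AutT X)" and g: "g \<in> carrier (AutT X)"
  then have fg: "f \<in> tree_auts X" "g \<in> tree_auts X" by (simp_all add: AutT_def)
  have "compose (lists X) g f \<in> tree_auts X"
  proof (rule tree_autsI)
    show "bij_betw (compose (lists X) g f) (lists X) (lists X)"
      using fg by (blast intro: bij_betw_compose tree_auts_bij)
    show "compose (lists X) g f [] = []" using fg by (simp add: compose_def tree_auts_def)
    fix u x assume u: "u \<in> lists X" and x: "x \<in> X"
    obtain y where "y \<in> X" "f (u @ [x]) = f u @ [y]" using tree_auts_snoc[OF fg(1) u x] by blast
    moreover obtain z where "z \<in> X" "g (f u @ [y]) = g (f u) @ [z]"
      using tree_auts_snoc[OF fg(2) tree_auts_lists[OF fg(1) u] \<open>y \<in> X\<close>] by blast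
    ultimately show "\<exists>y\<in>X. compose (lists X) g f (u @ [x]) = compose (lists X) g f u @ [y]"
      using u x by (auto simp: compose_def)
  qed (simp add: compose_def)
  then show "f \<otimes>\<^bsub>AutT X\<^esub> g \<in> carrier (AutT X)" by (simp add: AutT_def)
next
  show "\<one>\<^bsub>AutT X\<^esub> \<in> carrier (AutT X)"
    by (auto simp: AutT_def tree_auts_def Bij_def bij_betw_def inj_on_def)
next
  fix f g h assume "f \<in> carrier (AutT X)" "g \<in> carrier (AutT X)" "h \<in> carrier (AutT X)"
  then show "f \<otimes>\<^bsub>AutT X\<^esub> g \<otimes>\<^bsub>AutT X\<^esub> h = f \<otimes>\<^bsub>AutT X\<^esub> (g \<otimes>\<^bsub>AutT X\<^esub> h)"
    by (auto simp: AutT_def compose_def tree_auts_lists)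
next
  fix f assume "f \<in> carrier (AutT X)"
  then have f: "f \<in> tree_auts X" by (simp add: AutT_def)
  then show "\<one>\<^bsub>AutT X\<^esub> \<otimes>\<^bsub>AutT X\<^esub> f = f"
    by (auto simp: AutT_def compose_def tree_auts_def Bij_def extensional_def)
  let ?h = "restrict (inv_into (lists X) f) (lists X)"
  note bij = tree_auts_bij[OF f]
  have hB: "bij_betw ?h (lists X) (lists X)"
    using bij_betw_inv_into[OF bij] by simp
  have h_mem: "?h u \<in> lists X" if "u \<in> lists X" for u using hB that bij_betwE by blast
  have fh: "f (?h u) = u" if "u \<in> lists X" for u
    using that bij by (simp add: bij_betw_inv_into_right)
  have hf: "?h (f u) = u" if "u \<in> lists X" for u
    using that bij tree_auts_lists[OF f that] by (simp add: bij_betw_inv_into_left)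
  have "f [] = []" using f by (simp add: tree_auts_def)
  then have "?h [] = []" using hf[of "[]"] by simp
  moreover have "tree_adj X (?h u) (?h v) = tree_adj X u v"
    if "u \<in> lists X" "v \<in> lists X" for u v
    using f h_mem[OF that(1)] h_mem[OF that(2)] fh[OF that(1)] fh[OF that(2)]
    unfolding tree_auts_def mem_Collect_eq by metis
  ultimately have "?h \<in> tree_auts X"
    using hB unfolding tree_auts_def Bij_def by blast
  moreover have "compose (lists X) f ?h = (\<lambda>u\<in>lists X. u)"
    using fh by (auto simp: compose_def fun_eq_iff)
  ultimately show "\<exists>h\<in>carrier (AutT X). h \<otimes>\<^bsub>AutT X\<^esub> f = \<one>\<^bsub>AutT X\<^esub>"
    by (auto simp: AutT_def)
qed

lemma b_word_lists:
  assumes "x i \<in> X" "x (i + 1) \<in> X" "u \<in> lists X"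
  shows "b_word x i u \<in> lists X"
  using assms(3)
proof (induction u)
  case (Cons y u)
  then show ?case using assms(1,2) by (auto simp: Transposition.transpose_def)
qed simp

lemma b_word_involution: "b_word x i (b_word x i u) = u"
  by (induction u) (auto simp: Transposition.transpose_def)

lemma b_word_snoc:
  assumes "x i \<in> X" "x (i + 1) \<in> X" "u \<in> lists X" "z \<in> X"
  shows "\<exists>y\<in>X. b_word x i (u @ [z]) = b_word x i u @ [y]"
  using assms(3)
proof (induction u)
  case Nil
  then show ?case using assms by (simp add: Transposition.transpose_def)
next
  case (Cons y u)
  then show ?case using assms(4) by auto
qed

lemma gen_b_in_tree_auts:
  assumes xi: "x i \<in> X" "x (i + 1) \<in> X"
  shows "gen_b X x i \<in> tree_auts X"
proof (rule tree_autsI)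
  show "bij_betw (gen_b X x i) (lists X) (lists X)"
  proof (rule bij_betw_byWitness[where f' = "gen_b X x i"])
    have mem: "b_word x i u \<in> lists X" if "u \<in> lists X" for u
      using b_word_lists[of x i X u] xi that by simp
    show "\<forall>u\<in>lists X. gen_b X x i (gen_b X x i u) = u"
      using mem by (simp add: gen_b_def b_word_involution del: in_lists_conv_set)
    then show "\<forall>u\<in>lists X. gen_b X x i (gen_b X x i u) = u" .
    show "gen_b X x i ` lists X \<subseteq> lists X" "gen_b X x i ` lists X \<subseteq> lists X"
      using mem by (auto simp: gen_b_def simp del: in_lists_conv_set)
  qed
  show "\<exists>y\<in>X. gen_b X x i (u @ [z]) = gen_b X x i u @ [y]" if "u \<in> lists X" "z \<in> X" for u z
    using b_word_snoc[of x i X u z] xi that by (simp add: gen_b_def)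
qed (simp_all add: gen_b_def)

lemma gen_b_characterization:
  assumes x: "bij_betw x {1..d} X" and i: "i \<in> {1..d - 1}"
  shows "gen_b X x i \<in> carrier (AutT X)"
    and "label X (gen_b X x i) [] = Transposition.transpose (x i) (x (i + 1))"
    and "k \<in> {1..d} \<Longrightarrow> vertex_section X (gen_b X x i) [x k] =
           (if k \<in> {i, i + 1} then \<one>\<^bsub>AutT X\<^esub> else gen_b X x i)"
proof -
  have ii: "i \<in> {1..d}" "i + 1 \<in> {1..d}" using i by auto
  have xi: "x i \<in> X" "x (i + 1) \<in> X" using bij_betwE[OF x] ii by blast+
  show "gen_b X x i \<in> carrier (AutT X)" using gen_b_in_tree_auts[of x i X] xi by (simp add: AutT_def)
  show "label X (gen_b X x i) [] = Transposition.transpose (x i) (x (i + 1))"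
    using xi by (auto simp: label_def gen_b_def fun_eq_iff Transposition.transpose_def)
  assume k: "k \<in> {1..d}"
  have xk: "x k \<in> X" using bij_betwE[OF x] k by blast
  have "x k \<in> {x i, x (i + 1)} \<longleftrightarrow> k \<in> {i, i + 1}"
    using x ii k unfolding bij_betw_def inj_on_def by blast
  then show "vertex_section X (gen_b X x i) [x k] =
           (if k \<in> {i, i + 1} then \<one>\<^bsub>AutT X\<^esub> else gen_b X x i)"
    using xk by (auto simp: vertex_section_def gen_b_def AutT_def fun_eq_iff restrict_def)
qed

lemma gen_b_unique:
  assumes x: "bij_betw x {1..d} X" and i: "i \<in> {1..d - 1}"
    and g: "g \<in> carrier (AutT X)"
    and lab: "label X g [] = Transposition.transpose (x i) (x (i + 1))"
    and sec: "\<And>k. k \<in> {1..d} \<Longrightarrow> vertex_section X g [x k] =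
           (if k \<in> {i, i + 1} then \<one>\<^bsub>AutT X\<^esub> else g)"
  shows "g = gen_b X x i"
proof -
  have g': "g \<in> tree_auts X" using g by (simp add: AutT_def)
  have ii: "i \<in> {1..d}" "i + 1 \<in> {1..d}" using i by auto
  have "g u = b_word x i u" if "u \<in> lists X" for u
    using that
  proof (induction u)
    case Nil
    show ?case using g' by (simp add: tree_auts_def)
  next
    case (Cons y u)
    then have y: "y \<in> X" and u: "u \<in> lists X" by auto
    obtain k where k: "k \<in> {1..d}" "y = x k" using x y by (auto simp: bij_betw_def)
    have eq: "x k \<in> {x i, x (i + 1)} \<longleftrightarrow> k \<in> {i, i + 1}"
      using x ii k(1) unfolding bij_betw_def inj_on_def by blast
    have "g [] = []" using g' by (simp add: tree_auts_def)
    then have gy: "g [y] = [Transposition.transpose (x i) (x (i + 1)) y]"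
      using label_eq(2)[OF g', of "[]" y] y lab by simp
    have "g (y # u) = g [y] @ vertex_section X g [x k] u"
      using vertex_section_eq[OF g', of "[y]" u] y u k by simp
    also have "vertex_section X g [x k] u =
        (if y \<in> {x i, x (i + 1)} then u else b_word x i u)"
      unfolding sec[OF k(1)] using eq k u Cons.IH by (simp add: AutT_def)
    finally show ?case using gy by simp
  qed
  moreover have "g \<in> extensional (lists X)" using g' by (simp add: tree_auts_def Bij_def)
  ultimately show ?thesis
    by (auto simp: gen_b_def fun_eq_iff extensional_def simp del: in_lists_conv_set)
qed

end

theory Submission
  imports Defs "HOL-Combinatorics.Permutations"
begin

text \<open>
  All three claims rest on two observations about words in the generators \<open>b\<^sub>i\<close>.

  Transitivity and fractality. Following a letter along the path \<open>x\<^sub>1, \<dots>, x\<^sub>d\<close> by the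
  generators that move it, one reaches every other letter with trivial section, because
  \<open>b\<^sub>i\<close> has trivial sections exactly at the two letters it moves. Since \<open>d \<ge> 3\<close>, for each
  \<open>i\<close> there is a letter fixed by \<open>b\<^sub>i\<close>, where the section of \<open>b\<^sub>i\<close> is \<open>b\<^sub>i\<close> itself; conjugating
  by such paths puts \<open>b\<^sub>i\<close> as a section at any letter. Hence for letters \<open>a, b\<close> and \<open>h \<in> G\<close>
  there is \<open>g \<in> G\<close> with \<open>g (a w) = b (h w)\<close> for all \<open>w\<close> (lemma \<open>carries_letters\<close>), and the same
  for words of equal length in place of \<open>a, b\<close> (lemma \<open>carries_words\<close>). Equal words give
  fractality, and \<open>h = 1\<close> gives level transitivity.

  Failure of strong fractality. Let a word in the generators represent \<open>g\<close>. At a letter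
  \<open>x\<^sub>k\<close>, each generator in the word either moves the current image of \<open>x\<^sub>k\<close> one step along
  the path and contributes nothing to the section, or fixes it and contributes itself. So
  the parity of the section at \<open>x\<^sub>k\<close>, the parity of the number of steps and the parity of
  the root label of \<open>g\<close> add up to zero (lemma \<open>sign_label_letter\<close>). If \<open>g\<close> fixes the first
  level, the root label is trivial and the walk of \<open>x\<^sub>k\<close> is closed, hence of even length;
  so the section is even at the root and cannot be \<open>b\<^sub>1\<close>.
\<close>

section \<open>Products, sections and labels of tree automorphisms\<close>

lemma AutT_mult_apply: "u \<in> lists X \<Longrightarrow> (f \<otimes>\<^bsub>AutT X\<^esub> g) u = g (f u)"
  by (simp add: AutT_def compose_def)

lemma AutT_one_apply: "u \<in> lists X \<Longrightarrow> \<one>\<^bsub>AutT X\<^esub> u = u"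
  by (simp add: AutT_def)

lemma tree_auts_eqI:
  assumes "f \<in> tree_auts X" "g \<in> tree_auts X" "\<And>w. w \<in> lists X \<Longrightarrow> f w = g w"
  shows "f = g"
  using assms by (intro extensionalityI[of f "lists X" g]) (auto simp: tree_auts_def Bij_def)

lemma tree_auts_mult:
  "f \<in> tree_auts X \<Longrightarrow> g \<in> tree_auts X \<Longrightarrow> f \<otimes>\<^bsub>AutT X\<^esub> g \<in> tree_auts X"
  using monoid.m_closed[OF group.is_monoid[OF group_AutT], of f X g] by (simp add: AutT_def)

lemma tree_auts_one: "\<one>\<^bsub>AutT X\<^esub> \<in> tree_auts X"
  using monoid.one_closed[OF group.is_monoid[OF group_AutT], of X] by (simp add: AutT_def)

lemma AutT_one_mult: "f \<in> tree_auts X \<Longrightarrow> \<one>\<^bsub>AutT X\<^esub> \<otimes>\<^bsub>AutT X\<^esub> f = f"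
  and AutT_mult_one: "f \<in> tree_auts X \<Longrightarrow> f \<otimes>\<^bsub>AutT X\<^esub> \<one>\<^bsub>AutT X\<^esub> = f"
  using monoid.l_one[OF group.is_monoid[OF group_AutT], of f X]
    monoid.r_one[OF group.is_monoid[OF group_AutT], of f X] by (simp_all add: AutT_def)

lemma vertex_section_one: "u \<in> lists X \<Longrightarrow> vertex_section X \<one>\<^bsub>AutT X\<^esub> u = \<one>\<^bsub>AutT X\<^esub>"
  by (auto simp: vertex_section_def AutT_def fun_eq_iff)

lemma vertex_section_mult:
  assumes f: "f \<in> tree_auts X" and g: "g \<in> tree_auts X" and u: "u \<in> lists X"
  shows "vertex_section X (f \<otimes>\<^bsub>AutT X\<^esub> g) u
    = vertex_section X f u \<otimes>\<^bsub>AutT X\<^esub> vertex_section X g (f u)"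
proof (rule tree_auts_eqI)
  note fu = tree_auts_lists[OF f u]
  note fg = tree_auts_mult[OF f g]
  note sf = vertex_section_in_tree_auts[OF f u]
  show "vertex_section X (f \<otimes>\<^bsub>AutT X\<^esub> g) u \<in> tree_auts X"
    by (rule vertex_section_in_tree_auts[OF fg u])
  show "vertex_section X f u \<otimes>\<^bsub>AutT X\<^esub> vertex_section X g (f u) \<in> tree_auts X"
    by (rule tree_auts_mult[OF sf vertex_section_in_tree_auts[OF g fu]])
  fix w assume w: "w \<in> lists X"
  have uw: "u @ w \<in> lists X" using u w by simp
  show "vertex_section X (f \<otimes>\<^bsub>AutT X\<^esub> g) u w
    = (vertex_section X f u \<otimes>\<^bsub>AutT X\<^esub> vertex_section X g (f u)) w"
    using vertex_section_eq[OF fg u w] vertex_section_eq[OF f u w]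
      vertex_section_eq[OF g fu tree_auts_lists[OF sf w]]
    by (simp add: AutT_mult_apply[OF uw] AutT_mult_apply[OF u] AutT_mult_apply[OF w])
qed

lemma label_mult:
  assumes f: "f \<in> tree_auts X" and g: "g \<in> tree_auts X" and u: "u \<in> lists X"
  shows "label X (f \<otimes>\<^bsub>AutT X\<^esub> g) u = label X g (f u) \<circ> label X f u"
proof
  fix a
  have "u @ [a] \<in> lists X" if "a \<in> X" using u that by simp
  then show "label X (f \<otimes>\<^bsub>AutT X\<^esub> g) u a = (label X g (f u) \<circ> label X f u) a"
    using tree_auts_snoc[OF f u, of a] by (auto simp: label_def AutT_mult_apply)
qed

lemma label_one: "u \<in> lists X \<Longrightarrow> label X \<one>\<^bsub>AutT X\<^esub> u = id"
  by (auto simp: label_def AutT_def fun_eq_iff)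

lemma label_section:
  assumes g: "g \<in> tree_auts X" and u: "u \<in> lists X"
  shows "label X (vertex_section X g u) [] = label X g u"
proof
  fix a
  show "label X (vertex_section X g u) [] a = label X g u a"
    using tree_auts_snoc[OF g u, of a] by (auto simp: label_def vertex_section_def)
qed

lemma permutation_label:
  assumes g: "g \<in> tree_auts X" and u: "u \<in> lists X" and X: "finite X"
  shows "permutation (label X g u)"
proof -
  have "inj_on (label X g u) X"
  proof (rule inj_onI)
    fix a b assume "a \<in> X" "b \<in> X" "label X g u a = label X g u b"
    then show "a = b"
      using label_eq(2)[OF g u, of a] label_eq(2)[OF g u, of b]
        tree_auts_inj[OF g, of "u @ [a]" "u @ [b]"] u by simp
  qed
  moreover have "label X g u ` X \<subseteq> X" using label_eq(1)[OF g u] by blast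
  ultimately have "bij_betw (label X g u) X X"
    using endo_inj_surj[OF X] by (simp add: bij_betw_def)
  then have "label X g u permutes X" by (rule bij_imp_permutes) (simp add: label_def)
  with X show ?thesis unfolding permutation_permutes by blast
qed

section \<open>The group generated by the adjacent swaps\<close>

lemma b_word_append:
  "b_word x i (u @ v)
    = b_word x i u @ (if set u \<inter> {x i, x (i + 1)} = {} then b_word x i v else v)"
  by (induction u) auto

lemma length_b_word: "length (b_word x i u) = length u"
  by (induction u) auto

locale adjacent_swaps =
  fixes d :: nat and X :: "'a set" and x :: "nat \<Rightarrow> 'a"
  assumes d: "d \<ge> 3" and x: "bij_betw x {1..d} X"
begin

abbreviation b :: "nat \<Rightarrow> 'a list \<Rightarrow> 'a list" where "b \<equiv> gen_b X x"

definition G :: "('a list \<Rightarrow> 'a list) set" where "G = generate (AutT X) (b ` {1..d - 1})"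

lemma finite_X: "finite X"
  using bij_betw_finite[OF x] by simp

lemma x_in: "k \<in> {1..d} \<Longrightarrow> x k \<in> X"
  using bij_betwE[OF x] by blast

lemma x_eq_iff: "k \<in> {1..d} \<Longrightarrow> l \<in> {1..d} \<Longrightarrow> x k = x l \<longleftrightarrow> k = l"
  by (rule inj_on_eq_iff[OF bij_betw_imp_inj_on[OF x]])

lemma X_cases:
  assumes "a \<in> X" obtains k where "k \<in> {1..d}" "a = x k"
  using that assms bij_betw_imp_surj_on[OF x] by blast

lemma b_tree_auts: "i \<in> {1..d - 1} \<Longrightarrow> b i \<in> tree_auts X"
  using gen_b_characterization(1)[OF x] by (simp add: AutT_def)

lemma inv_b:
  assumes i: "i \<in> {1..d - 1}"
  shows "inv\<^bsub>AutT X\<^esub> (b i) = b i"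
proof (rule group.inv_equality[OF group_AutT])
  show c: "b i \<in> carrier (AutT X)" by (rule gen_b_characterization(1)[OF x i])
  show "b i \<in> carrier (AutT X)" by (rule c)
  show "b i \<otimes>\<^bsub>AutT X\<^esub> b i = \<one>\<^bsub>AutT X\<^esub>"
  proof (rule tree_auts_eqI)
    show "b i \<otimes>\<^bsub>AutT X\<^esub> b i \<in> tree_auts X" using b_tree_auts[OF i] by (blast intro: tree_auts_mult)
    fix w assume w: "w \<in> lists X"
    have "b i w \<in> lists X" using tree_auts_lists[OF b_tree_auts[OF i] w] .
    then have "b i (b i w) = w" using w by (simp add: gen_b_def b_word_involution)
    then show "(b i \<otimes>\<^bsub>AutT X\<^esub> b i) w = \<one>\<^bsub>AutT X\<^esub> w"
      using w by (simp only: AutT_mult_apply AutT_one_apply)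
  qed (rule tree_auts_one)
qed

lemma subgroup_G: "subgroup G (AutT X)"
  unfolding G_def
  by (intro group.generate_is_subgroup[OF group_AutT] image_subsetI gen_b_characterization(1)[OF x])

lemma G_tree_auts: "g \<in> G \<Longrightarrow> g \<in> tree_auts X"
  using subsetD[OF subgroup.subset[OF subgroup_G]] by (simp add: AutT_def)

lemma G_one: "\<one>\<^bsub>AutT X\<^esub> \<in> G"
  by (rule subgroup.one_closed[OF subgroup_G])

lemma G_mult: "f \<in> G \<Longrightarrow> g \<in> G \<Longrightarrow> f \<otimes>\<^bsub>AutT X\<^esub> g \<in> G"
  by (rule subgroup.m_closed[OF subgroup_G])

lemma G_b: "i \<in> {1..d - 1} \<Longrightarrow> b i \<in> G"
  unfolding G_def by (intro generate.incl imageI)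

text \<open>
  As the generators are involutions, every element of the group is a product of generators,
  so inverses need no separate case in inductions.
\<close>

lemma G_induct [consumes 1, case_names one gen mult]:
  assumes "g \<in> G"
    and "P \<one>\<^bsub>AutT X\<^esub>"
    and "\<And>i. i \<in> {1..d - 1} \<Longrightarrow> P (b i)"
    and "\<And>f g. f \<in> G \<Longrightarrow> g \<in> G \<Longrightarrow> P f \<Longrightarrow> P g \<Longrightarrow> P (f \<otimes>\<^bsub>AutT X\<^esub> g)"
  shows "P g"
  using assms(1) unfolding G_def
proof (induction rule: generate.induct)
  case one
  show ?case by (rule assms(2))
next
  case (incl h)
  then show ?case using assms(3) by blast
next
  case (inv h)
  then show ?case using assms(3) inv_b by auto
next
  case (eng f g)
  then show ?case using assms(4) unfolding G_def by blast
qed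

lemma vertex_section_b:
  assumes i: "i \<in> {1..d - 1}" and u: "u \<in> lists X"
  shows "vertex_section X (b i) u
    = (if set u \<inter> {x i, x (i + 1)} = {} then b i else \<one>\<^bsub>AutT X\<^esub>)"
  using u by (auto simp: fun_eq_iff vertex_section_def gen_b_def AutT_def
      b_word_append length_b_word restrict_def)

lemma self_similar_G: "self_similar X G"
proof -
  have "\<forall>u\<in>lists X. vertex_section X g u \<in> G" if "g \<in> G" for g
    using that
  proof (induction rule: G_induct)
    case one
    show ?case by (simp add: vertex_section_one G_one del: in_lists_conv_set)
  next
    case (gen i)
    then show ?case using vertex_section_b[OF gen] G_b[OF gen] G_one by simp
  next
    case (mult f g)
    then show ?case
      using vertex_section_mult[OF G_tree_auts G_tree_auts] tree_auts_lists[OF G_tree_auts] G_mult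
      by metis
  qed
  then show ?thesis using subgroup_G by (simp add: self_similar_def del: in_lists_conv_set)
qed

section \<open>Prescribing sections: transitivity and fractality\<close>

definition carries :: "('a list \<Rightarrow> 'a list) \<Rightarrow> 'a list \<Rightarrow> 'a list \<Rightarrow> bool" where
  "carries h u v \<longleftrightarrow> (\<exists>g\<in>G. \<forall>w\<in>lists X. g (u @ w) = v @ h w)"

lemma carries_mult:
  assumes "carries f u v" "carries g v w" "u \<in> lists X" "f \<in> G"
  shows "carries (f \<otimes>\<^bsub>AutT X\<^esub> g) u w"
proof -
  obtain f' where f': "f' \<in> G" "\<And>t. t \<in> lists X \<Longrightarrow> f' (u @ t) = v @ f t"
    using assms(1) unfolding carries_def by blast
  obtain g' where g': "g' \<in> G" "\<And>t. t \<in> lists X \<Longrightarrow> g' (v @ t) = w @ g t"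
    using assms(2) unfolding carries_def by blast
  have "(f' \<otimes>\<^bsub>AutT X\<^esub> g') (u @ t) = w @ (f \<otimes>\<^bsub>AutT X\<^esub> g) t" if t: "t \<in> lists X" for t
  proof -
    have ut: "u @ t \<in> lists X" using assms(3) t by simp
    have ft: "f t \<in> lists X" using tree_auts_lists[OF G_tree_auts[OF assms(4)] t] .
    show ?thesis
      by (simp only: AutT_mult_apply[OF ut] AutT_mult_apply[OF t] f'(2)[OF t] g'(2)[OF ft])
  qed
  then show ?thesis using G_mult[OF f'(1) g'(1)] unfolding carries_def by blast
qed

lemma carries_one_trans:
  assumes "carries \<one>\<^bsub>AutT X\<^esub> u v" "carries \<one>\<^bsub>AutT X\<^esub> v w" "u \<in> lists X"
  shows "carries \<one>\<^bsub>AutT X\<^esub> u w"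
  using carries_mult[OF assms G_one] by (simp add: AutT_one_mult[OF tree_auts_one])

lemma carries_step:
  assumes i: "i \<in> {1..d - 1}"
  shows "carries \<one>\<^bsub>AutT X\<^esub> [x i] [x (i + 1)]" "carries \<one>\<^bsub>AutT X\<^esub> [x (i + 1)] [x i]"
proof -
  have "i \<in> {1..d}" "i + 1 \<in> {1..d}" using i by auto
  note xi = this[THEN x_in]
  show "carries \<one>\<^bsub>AutT X\<^esub> [x i] [x (i + 1)]" "carries \<one>\<^bsub>AutT X\<^esub> [x (i + 1)] [x i]"
    unfolding carries_def using xi by (auto intro!: bexI[OF _ G_b[OF i]] simp: gen_b_def AutT_def)
qed

text \<open>A walk along the path moves a letter by generators whose section there is trivial.\<close>

lemma carries_one_letters:
  assumes k: "k \<in> {1..d}" and l: "l \<in> {1..d}"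
  shows "carries \<one>\<^bsub>AutT X\<^esub> [x k] [x l]"
proof -
  have walk: "l \<le> d \<longrightarrow> carries \<one>\<^bsub>AutT X\<^esub> [x k] [x l] \<and> carries \<one>\<^bsub>AutT X\<^esub> [x l] [x k]"
    if "k \<le> l" "1 \<le> k" for k l
    using \<open>k \<le> l\<close>
  proof (induction l rule: dec_induct)
    case base
    show ?case unfolding carries_def using that x_in[of k]
      by (auto intro!: bexI[OF _ G_one] simp: AutT_def)
  next
    case (step l)
    show ?case
    proof
      assume l: "Suc l \<le> d"
      then have i: "l \<in> {1..d - 1}" using step that by simp
      have mem: "[x k] \<in> lists X" "[x (Suc l)] \<in> lists X" using step that l x_in by auto
      have edge: "carries \<one>\<^bsub>AutT X\<^esub> [x l] [x (Suc l)]" "carries \<one>\<^bsub>AutT X\<^esub> [x (Suc l)] [x l]"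
        using carries_step[OF i] by simp_all
      have IH: "carries \<one>\<^bsub>AutT X\<^esub> [x k] [x l]" "carries \<one>\<^bsub>AutT X\<^esub> [x l] [x k]"
        using step.IH l by simp_all
      show "carries \<one>\<^bsub>AutT X\<^esub> [x k] [x (Suc l)] \<and> carries \<one>\<^bsub>AutT X\<^esub> [x (Suc l)] [x k]"
        using carries_one_trans[OF IH(1) edge(1) mem(1)] carries_one_trans[OF edge(2) IH(2) mem(2)]
        by blast
    qed
  qed
  show ?thesis using walk[of k l] walk[of l k] k l by (cases "k \<le> l") auto
qed

lemma carries_letters:
  assumes "h \<in> G" "k \<in> {1..d}" "l \<in> {1..d}"
  shows "carries h [x k] [x l]"
  using assms
proof (induction arbitrary: k l rule: G_induct)
  case one
  then show ?case by (rule carries_one_letters)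
next
  case (gen i)
  \<comment> \<open>The third letter provided by \<open>d \<ge> 3\<close>: \<open>b i\<close> fixes it and has itself as section there.\<close>
  define j :: nat where "j = (if i = 1 then 3 else 1)"
  have j: "j \<in> {1..d}" "j \<noteq> i" "j \<noteq> i + 1" using d gen by (auto simp: j_def)
  have ii: "i \<in> {1..d}" "i + 1 \<in> {1..d}" using gen by auto
  have ne: "x j \<noteq> x i" "x j \<noteq> x (i + 1)" using x_eq_iff[OF j(1)] ii j by blast+
  have "carries (b i) [x j] [x j]"
    unfolding carries_def using ne x_in[OF j(1)]
    by (auto intro!: bexI[OF _ G_b[OF gen(1)]] simp: gen_b_def)
  then have "carries (\<one>\<^bsub>AutT X\<^esub> \<otimes>\<^bsub>AutT X\<^esub> b i) [x k] [x j]"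
    using carries_mult[OF carries_one_letters[OF gen(2) j(1)]] G_one x_in[OF gen(2)] by simp
  from carries_mult[OF this carries_one_letters[OF j(1) gen(3)]]
  have "carries (\<one>\<^bsub>AutT X\<^esub> \<otimes>\<^bsub>AutT X\<^esub> b i \<otimes>\<^bsub>AutT X\<^esub> \<one>\<^bsub>AutT X\<^esub>) [x k] [x l]"
    using G_mult[OF G_one G_b[OF gen(1)]] x_in[OF gen(2)] by simp
  then show ?case
    using b_tree_auts[OF gen(1)] by (simp add: AutT_one_mult AutT_mult_one)
next
  case (mult f g)
  show ?case
    using mult.IH(1)[OF mult.prems(1) mult.prems(1)] mult.IH(2)[OF mult.prems] mult.hyps
      x_in[OF mult.prems(1)]
    by (intro carries_mult) auto
qed

text \<open>
  The element obtained for the tails of the two words is in turn prescribed as the section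
  at the first letter.
\<close>

lemma carries_words:
  assumes "h \<in> G" "u \<in> lists X" "v \<in> lists X" "length u = length v"
  shows "carries h u v"
  using assms(4,2,3)
proof (induction u v rule: list_induct2)
  case Nil
  show ?case unfolding carries_def by (intro bexI[OF _ assms(1)]) simp
next
  case (Cons a u c v)
  then obtain g where g: "g \<in> G" "\<And>w. w \<in> lists X \<Longrightarrow> g (u @ w) = v @ h w"
    unfolding carries_def by auto
  have "a \<in> X" "c \<in> X" using Cons.prems by auto
  then obtain k l where kl: "k \<in> {1..d}" "a = x k" "l \<in> {1..d}" "c = x l"
    by (elim X_cases)
  obtain f where f: "f \<in> G" "\<And>w. w \<in> lists X \<Longrightarrow> f (a # w) = c # g w"
    using carries_letters[OF g(1) kl(1,3)] kl unfolding carries_def by auto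
  have "f ((a # u) @ w) = (c # v) @ h w" if "w \<in> lists X" for w
    using f(2)[of "u @ w"] g(2)[OF that] that Cons.prems by simp
  then show ?case using f(1) unfolding carries_def by blast
qed

lemma level_transitive_G: "level_transitive X G"
  unfolding level_transitive_def
proof (intro allI ballI)
  fix n u v assume "u \<in> level X n" "v \<in> level X n"
  then have uv: "u \<in> lists X" "v \<in> lists X" "length u = length v"
    unfolding level_def by auto
  obtain g where g: "g \<in> G" "\<And>w. w \<in> lists X \<Longrightarrow> g (u @ w) = v @ \<one>\<^bsub>AutT X\<^esub> w"
    using carries_words[OF G_one uv] unfolding carries_def by blast
  have "g u = v" using g(2)[of "[]"] by (simp add: AutT_one_apply)
  with g(1) show "\<exists>g\<in>G. g u = v" by blast
qed

lemma fractal_G: "fractal X G"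
  unfolding fractal_def
proof (intro conjI ballI self_similar_G equalityI subsetI)
  fix u h assume u: "u \<in> lists X"
  show "h \<in> G" if "h \<in> (\<lambda>g. vertex_section X g u) ` vertex_stab G u"
    using that self_similar_G u unfolding self_similar_def vertex_stab_def by blast
  assume h: "h \<in> G"
  obtain g where g: "g \<in> G" "\<And>w. w \<in> lists X \<Longrightarrow> g (u @ w) = u @ h w"
    using carries_words[OF h u u] unfolding carries_def by blast
  have "h [] = []" using G_tree_auts[OF h] by (simp add: tree_auts_def)
  then have stab: "g u = u" using g(2)[of "[]"] by simp
  have "h = vertex_section X g u"
  proof (rule tree_auts_eqI[OF G_tree_auts[OF h]])
    show "vertex_section X g u \<in> tree_auts X"
      by (rule vertex_section_in_tree_auts[OF G_tree_auts[OF g(1)] u])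
    show "h w = vertex_section X g u w" if "w \<in> lists X" for w
      using vertex_section_eq[OF G_tree_auts[OF g(1)] u that] g(2)[OF that] stab by simp
  qed
  with g(1) stab show "h \<in> (\<lambda>g. vertex_section X g u) ` vertex_stab G u"
    unfolding vertex_stab_def by blast
qed

section \<open>Parity of the first-level sections\<close>

text \<open>
  Both sides are multiplicative along products, so the identity needs checking only on a
  generator: there the right-hand side is \<open>-1\<close>, and on the left exactly one factor is, the
  first if the generator fixes \<open>x k\<close> and the second if it moves \<open>x k\<close> to a neighbour. The
  exponent \<open>k + l\<close> has the parity of the length of any walk from \<open>k\<close> to \<open>l\<close>.
\<close>

lemma sign_label_letter:
  assumes "g \<in> G" "k \<in> {1..d}" "l \<in> {1..d}" "g [x k] = [x l]"
  shows "sign (label X g [x k]) * (- 1) ^ (k + l) = sign (label X g [])"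
  using assms
proof (induction arbitrary: k l rule: G_induct)
  case one
  then have "[x k] \<in> lists X" using x_in by simp
  moreover from this have "k = l" using one x_eq_iff[of k l] by (simp add: AutT_one_apply)
  ultimately show ?case by (simp add: label_one sign_id flip: mult_2)
next
  case (gen i)
  have ii: "i \<in> {1..d}" "i + 1 \<in> {1..d}" using gen(1) by auto
  have xk: "x k \<in> X" by (rule x_in[OF gen(2)])
  have ne: "x i \<noteq> x (i + 1)" using x_eq_iff[OF ii] by simp
  have root: "sign (label X (b i) []) = - 1"
    using gen_b_characterization(2)[OF x gen(1)] ne sign_swap_id[of "x i" "x (i + 1)"] by simp
  have move: "x l = Transposition.transpose (x i) (x (i + 1)) (x k)"
    using gen(4) xk by (simp add: gen_b_def)
  have lab: "label X (b i) [x k] = label X (vertex_section X (b i) [x k]) []"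
    using label_section[OF b_tree_auts[OF gen(1)], of "[x k]"] xk by simp
  show ?case
  proof (cases "k \<in> {i, i + 1}")
    case True
    then have "label X (b i) [x k] = id"
      unfolding lab gen_b_characterization(3)[OF x gen(1,2)] by (simp add: label_one)
    moreover have "k + l = 2 * i + 1"
      using True move x_eq_iff[OF gen(3) ii(1)] x_eq_iff[OF gen(3) ii(2)] by auto
    ultimately show ?thesis using root by (simp add: sign_id)
  next
    case False
    then have "label X (b i) [x k] = label X (b i) []"
      unfolding lab gen_b_characterization(3)[OF x gen(1,2)] by simp
    moreover have "x l = x k"
      using False move x_eq_iff[OF gen(2) ii(1)] x_eq_iff[OF gen(2) ii(2)] by simp
    then have "k = l" using x_eq_iff gen by blast
    ultimately show ?thesis by (simp flip: mult_2)
  qed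
next
  case (mult f g)
  note f = G_tree_auts[OF mult.hyps(1)] and g = G_tree_auts[OF mult.hyps(2)]
  have xk: "[x k] \<in> lists X" using x_in[OF mult.prems(1)] by simp
  have fNil: "f [] = []" using f by (simp add: tree_auts_def)
  obtain a where a: "a \<in> X" "f [x k] = [a]"
    using tree_auts_snoc[OF f, of "[]" "x k"] xk fNil by auto
  obtain m where m: "m \<in> {1..d}" "f [x k] = [x m]" using X_cases[OF a(1)] a(2) by metis
  have xm: "[x m] \<in> lists X" using x_in[OF m(1)] by simp
  have gm: "g [x m] = [x l]" using mult.prems(3) m(2) AutT_mult_apply[OF xk] by metis
  have letter: "sign (label X (f \<otimes>\<^bsub>AutT X\<^esub> g) [x k])
      = sign (label X g [x m]) * sign (label X f [x k])"
    using label_mult[OF f g xk] m(2)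
      permutation_label[OF g xm finite_X] permutation_label[OF f xk finite_X]
    by (simp add: sign_compose)
  have root: "sign (label X (f \<otimes>\<^bsub>AutT X\<^esub> g) []) = sign (label X g []) * sign (label X f [])"
    using label_mult[OF f g, of "[]"] fNil
      permutation_label[OF g _ finite_X, of "[]"] permutation_label[OF f _ finite_X, of "[]"]
    by (simp add: sign_compose)
  have "(- 1 :: int) ^ (k + l) = (- 1) ^ (k + m) * (- 1) ^ (m + l)"
    by (simp add: power_add flip: power_mult_distrib)
  then show ?case
    unfolding letter root
    using mult.IH(1)[OF mult.prems(1) m] mult.IH(2)[OF m(1) mult.prems(2) gm]
    by (metis mult.assoc mult.commute)
qed

lemma even_section_of_level_stab:
  assumes g: "g \<in> level_stab X G 1" and k: "k \<in> {1..d}"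
  shows "sign (label X (vertex_section X g [x k]) []) = 1"
proof -
  have gG: "g \<in> G" and fixed: "\<And>a. a \<in> X \<Longrightarrow> g [a] = [a]"
    using g by (auto simp: level_stab_def vertex_stab_def level_def)
  have "label X g [] = id" using fixed by (auto simp: label_def fun_eq_iff)
  then have "sign (label X g [x k]) = 1"
    using sign_label_letter[OF gG k k fixed[OF x_in[OF k]]]
    by (simp add: sign_id flip: mult_2)
  then show ?thesis using label_section[OF G_tree_auts[OF gG], of "[x k]"] x_in[OF k] by simp
qed

lemma not_strongly_fractal_G: "\<not> strongly_fractal X G"
proof
  assume "strongly_fractal X G"
  moreover have one: "1 \<in> {1..d}" "2 \<in> {1..d}" "1 \<in> {1..d - 1}" using d by auto
  ultimately have "b 1 \<in> (\<lambda>g. vertex_section X g [x 1]) ` level_stab X G 1"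
    using G_b[OF one(3)] x_in[OF one(1)] unfolding strongly_fractal_def by blast
  then have "sign (label X (b 1) []) = 1"
    using even_section_of_level_stab[OF _ one(1)] by auto
  moreover have "sign (label X (b 1) []) = - 1"
    using gen_b_characterization(2)[OF x one(3)] x_eq_iff[OF one(1,2)]
      sign_swap_id[of "x 1" "x 2"] by (simp add: numeral_2_eq_2)
  ultimately show False by simp
qed

end

theorem mainTheorem1:
  fixes d :: nat and X :: "'a set" and x :: "nat \<Rightarrow> 'a"
    and G :: "('a list \<Rightarrow> 'a list) set"
  assumes "d \<ge> 3"
    and "bij_betw x {1..d} X"
    and "G = generate (AutT X) (gen_b X x ` {1..d - 1})"
  shows "level_transitive X G \<and> fractal X G \<and> \<not> strongly_fractal X G"
proof -
  interpret A: adjacent_swaps d X x using assms(1,2) by unfold_locales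
  have "G = A.G" using assms(3) by (simp add: A.G_def)
  then show ?thesis
    using A.level_transitive_G A.fractal_G A.not_strongly_fractal_G by simp
qed

end
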